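(* Assume that for every $N$: $f_N(\beta')<+\infty$ for all $\beta'>0$ and $f_N$ is twice differentiable; and that there is an open interval $J\subset(0,\infty)$ on which $f_N$ is four times differentiable with $\sup_N|f_N^{(j)}(\beta')|\le C_{\beta'}$ for $j=0,\dots,4$, $\beta'\in J$, where $\beta'\mapsto C_{\beta'}$ is bounded on closed bounded subintervals of $J$. Let $\beta\in J$ with $\inf_Nf_N''(\beta)\ge\sigma_-^2>0$. Let $A=A_N$ be functions on $\Omega^N$, bounded uniformly in $N$, such that $u\mapsto\langle A|u\rangle_N$ is continuous around $u=u_N(\beta)$ uniformly in $N$: for every $\epsilon>0$ there is $\delta_\epsilon>0$, independent of $N$, with $|\langle A|u\rangle_N-\langle A|u_N(\beta)\rangle_N|<\epsilon$ whenever $|u-u_N(\beta)|<\delta_\epsilon$. Then $$\langle A\rangle_{\beta,N}-\langle A|u_N(\beta)\rangle_N\longrightarrow0\qquad\text{as }N\to\infty.$$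
   Context: For each $N$ consider $N$ particles with momenta ${\bf p}=(p_1,\dots,p_N)$, $p_i\in\mathbb R$, and positions ${\bf q}=(q_1,\dots,q_N)$, $q_i\in M$, where $M$ is a one-dimensional manifold with its volume measure; the phase space is $\Omega^N=(\mathbb R\times M)^N$ with reference measure $d{\bf p}\,d{\bf q}$. Write $\bar{\bf q}_i=(q_1,\dots,q_{i-1},q_{i+1},\dots,q_N)$. The Hamiltonian is $H_N=\sum_{i=1}^N X_i$ with $X_i=\frac{p_i^2}{2}+V(q_i,\bar{\bf q}_i)$, where $V$ is a regular (smooth) real function. Put $h_N=H_N/N$. Define $f_N(\beta)=\frac1N\log\int_{\Omega^N}e^{-\beta H_N}\,d{\bf p}\,d{\bf q}$, the canonical measure $\nu_{\beta,N}=e^{-\beta H_N-Nf_N(\beta)}\,d{\bf p}\,d{\bf q}$ with expectation $\langle\cdot\rangle_{\beta,N}$, and $u_N(\beta)=\langle h_N\rangle_{\beta,N}=-f_N'(\beta)$. Let $\mathcal F_{N,\beta}$ be the density of $h_N$ under $\nu_{\beta,N}$. The microcanonical average $\langle A|u\rangle_N$ is the conditional expectation of $A$ given $h_N=u$, i.e. $\langle A\,F(h_N)\rangle_{\beta,N}=\int F(u)\langle A|u\rangle_N\,\mathcal F_{N,\beta}(u)\,du$ for measurable $F$; it does not depend on $\beta$, and $V$ is assumed regular enough that (via the co-area formula) a regular version defined for every $u$ exists, which is the one used. *)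

theory Defs
  imports "HOL-Probability.Probability"
begin

section \<open>Differentiability classes\<close>

text \<open>Meaningful for open \<open>S\<close>: the iterated \<open>deriv\<close> at a point of \<open>S\<close> then only depends on the
  values of \<open>f\<close> on \<open>S\<close>.\<close>

definition times_differentiable_on :: "nat \<Rightarrow> (real \<Rightarrow> real) \<Rightarrow> real set \<Rightarrow> bool" where
  "times_differentiable_on k f S \<longleftrightarrow>
     (\<forall>j<k. \<forall>x\<in>S. (deriv ^^ j) f field_differentiable (at x))"

definition smooth_real_on :: "(real \<Rightarrow> real) \<Rightarrow> real set \<Rightarrow> bool" where
  "smooth_real_on f S \<longleftrightarrow> (\<forall>k. times_differentiable_on k f S)"

text \<open>Functions of finitely many real variables, indexed by a finite set \<open>I\<close> (the dimension varies,
  so it cannot be a type). The set \<open>S\<close> is a relatively open subset of \<open>I \<rightarrow>\<^sub>E UNIV\<close>, on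
  which the topology of the function type is that of \<open>\<real>\<^sup>I\<close>.\<close>

definition partial_deriv :: "nat \<Rightarrow> ((nat \<Rightarrow> real) \<Rightarrow> real) \<Rightarrow> (nat \<Rightarrow> real) \<Rightarrow> real" where
  "partial_deriv i f x = deriv (\<lambda>t. f (x(i := t))) (x i)"

primrec C_k_on :: "nat \<Rightarrow> nat set \<Rightarrow> ((nat \<Rightarrow> real) \<Rightarrow> real) \<Rightarrow> (nat \<Rightarrow> real) set \<Rightarrow> bool" where
  "C_k_on 0 I f S \<longleftrightarrow> continuous_on S f"
| "C_k_on (Suc k) I f S \<longleftrightarrow> continuous_on S f \<and>
     (\<forall>i\<in>I. (\<forall>x\<in>S. (\<lambda>t. f (x(i := t))) field_differentiable (at (x i))) \<and>
             C_k_on k I (partial_deriv i f) S)"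

definition smooth_vars_on :: "nat set \<Rightarrow> ((nat \<Rightarrow> real) \<Rightarrow> real) \<Rightarrow> (nat \<Rightarrow> real) set \<Rightarrow> bool" where
  "smooth_vars_on I f S \<longleftrightarrow> (\<forall>k. C_k_on k I f S)"


section \<open>One-dimensional Riemannian manifolds\<close>

text \<open>A chart is a pair of its domain and its coordinate function. The manifold is the whole type;
  being Hausdorff and second countable is expressed by the type classes.\<close>

type_synonym 'm chart = "'m set \<times> ('m \<Rightarrow> real)"

definition is_chart :: "'m::topological_space chart \<Rightarrow> bool" where
  "is_chart c \<longleftrightarrow> (case c of (U, \<phi>) \<Rightarrow>
     open U \<and> open (\<phi> ` U) \<and> homeomorphism U (\<phi> ` U) \<phi> (inv_into U \<phi>))"

definition transition :: "'m chart \<Rightarrow> 'm chart \<Rightarrow> real \<Rightarrow> real" where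
  "transition c d = snd d \<circ> inv_into (fst c) (snd c)"

definition smooth_atlas :: "'m::{second_countable_topology, t2_space} chart set \<Rightarrow> bool" where
  "smooth_atlas \<A> \<longleftrightarrow>
     (\<forall>c\<in>\<A>. is_chart c) \<and> (\<Union>c\<in>\<A>. fst c) = UNIV \<and>
     (\<forall>c\<in>\<A>. \<forall>d\<in>\<A>. smooth_real_on (transition c d) (snd c ` (fst c \<inter> fst d)))"

text \<open>A metric is given by its single coefficient in each chart: \<open>ds\<^sup>2 = g c x dx\<^sup>2\<close>.\<close>

definition riemannian_metric ::
    "'m::{second_countable_topology, t2_space} chart set \<Rightarrow> ('m chart \<Rightarrow> real \<Rightarrow> real) \<Rightarrow> bool" where
  "riemannian_metric \<A> g \<longleftrightarrow>
     (\<forall>c\<in>\<A>. smooth_real_on (g c) (snd c ` fst c) \<and> (\<forall>x\<in>snd c ` fst c. g c x > 0)) \<and>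
     (\<forall>c\<in>\<A>. \<forall>d\<in>\<A>. \<forall>x\<in>snd c ` (fst c \<inter> fst d).
        g c x = g d (transition c d x) * (deriv (transition c d) x)\<^sup>2)"

text \<open>These conditions determine \<open>vol\<close> uniquely, since countably many charts cover the manifold.\<close>

definition volume_measure ::
    "'m::{second_countable_topology, t2_space} chart set \<Rightarrow> ('m chart \<Rightarrow> real \<Rightarrow> real) \<Rightarrow>
     'm measure \<Rightarrow> bool" where
  "volume_measure \<A> g vol \<longleftrightarrow>
     sets vol = sets borel \<and>
     (\<forall>c\<in>\<A>. \<forall>B\<in>sets borel. B \<subseteq> fst c \<longrightarrow>
        emeasure vol B = (\<integral>\<^sup>+x\<in>snd c ` B. ennreal (sqrt (g c x)) \<partial>lborel))"

text \<open>Smoothness of a function on the product manifold \<open>M\<^sup>I\<close>, tested in products of charts.\<close>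

definition smooth_on_power ::
    "'m::{second_countable_topology, t2_space} chart set \<Rightarrow> nat set \<Rightarrow> ((nat \<Rightarrow> 'm) \<Rightarrow> real) \<Rightarrow> bool"
  where
  "smooth_on_power \<A> I F \<longleftrightarrow>
     (\<forall>c. (\<forall>i\<in>I. c i \<in> \<A>) \<longrightarrow>
        smooth_vars_on I (\<lambda>x. F (\<lambda>i\<in>I. inv_into (fst (c i)) (snd (c i)) (x i)))
          (\<Pi>\<^sub>E i\<in>I. snd (c i) ` fst (c i)))"


section \<open>The particle system\<close>

text \<open>Particles are numbered by \<open>{1..N}\<close> and \<open>x i = (p\<^sub>i, q\<^sub>i)\<close>. The potential has type
  \<open>'m \<Rightarrow> 'm list \<Rightarrow> real\<close>: its second argument is the tuple of the \<open>N - 1\<close> other positions in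
  increasing order of their indices, so one \<open>V\<close> serves all \<open>N\<close> and may depend on \<open>N\<close> through the
  length of the list.\<close>

definition smooth_potential ::
    "'m::{second_countable_topology, t2_space} chart set \<Rightarrow> ('m \<Rightarrow> 'm list \<Rightarrow> real) \<Rightarrow> bool" where
  "smooth_potential \<A> V \<longleftrightarrow>
     (\<forall>N\<ge>1. smooth_on_power \<A> {1..N} (\<lambda>y. V (y 1) (map y [2..<Suc N])))"

definition phase_space :: "'m measure \<Rightarrow> nat \<Rightarrow> (nat \<Rightarrow> real \<times> 'm) measure" where
  "phase_space vol N = (\<Pi>\<^sub>M i\<in>{1..N}. lborel \<Otimes>\<^sub>M vol)"

definition other_positions :: "nat \<Rightarrow> (nat \<Rightarrow> real \<times> 'm) \<Rightarrow> nat \<Rightarrow> 'm list" where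
  "other_positions N x i = map (\<lambda>j. snd (x j)) ([1..<i] @ [Suc i..<Suc N])"

definition particle_energy ::
    "('m \<Rightarrow> 'm list \<Rightarrow> real) \<Rightarrow> nat \<Rightarrow> (nat \<Rightarrow> real \<times> 'm) \<Rightarrow> nat \<Rightarrow> real" where
  "particle_energy V N x i = (fst (x i))\<^sup>2 / 2 + V (snd (x i)) (other_positions N x i)"

definition hamiltonian ::
    "('m \<Rightarrow> 'm list \<Rightarrow> real) \<Rightarrow> nat \<Rightarrow> (nat \<Rightarrow> real \<times> 'm) \<Rightarrow> real" where
  "hamiltonian V N x = (\<Sum>i=1..N. particle_energy V N x i)"

definition mean_energy ::
    "('m \<Rightarrow> 'm list \<Rightarrow> real) \<Rightarrow> nat \<Rightarrow> (nat \<Rightarrow> real \<times> 'm) \<Rightarrow> real" where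
  "mean_energy V N x = hamiltonian V N x / real N"


section \<open>Canonical and microcanonical averages\<close>

definition partition_function ::
    "'m measure \<Rightarrow> ('m \<Rightarrow> 'm list \<Rightarrow> real) \<Rightarrow> nat \<Rightarrow> real \<Rightarrow> ennreal" where
  "partition_function vol V N \<beta> =
     (\<integral>\<^sup>+x. ennreal (exp (- \<beta> * hamiltonian V N x)) \<partial>phase_space vol N)"

text \<open>Real-valued; that \<open>f\<^sub>N(\<beta>) < +\<infinity>\<close> is expressed by \<open>partition_function vol V N \<beta> < \<infinity>\<close>.\<close>

definition free_energy ::
    "'m measure \<Rightarrow> ('m \<Rightarrow> 'm list \<Rightarrow> real) \<Rightarrow> nat \<Rightarrow> real \<Rightarrow> real" where
  "free_energy vol V N \<beta> = ln (enn2real (partition_function vol V N \<beta>)) / real N"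

definition canonical_measure ::
    "'m measure \<Rightarrow> ('m \<Rightarrow> 'm list \<Rightarrow> real) \<Rightarrow> nat \<Rightarrow> real \<Rightarrow> (nat \<Rightarrow> real \<times> 'm) measure" where
  "canonical_measure vol V N \<beta> =
     density (phase_space vol N)
       (\<lambda>x. ennreal (exp (- \<beta> * hamiltonian V N x - real N * free_energy vol V N \<beta>)))"

definition canonical_average ::
    "'m measure \<Rightarrow> ('m \<Rightarrow> 'm list \<Rightarrow> real) \<Rightarrow> nat \<Rightarrow> real \<Rightarrow>
     ((nat \<Rightarrow> real \<times> 'm) \<Rightarrow> real) \<Rightarrow> real" where
  "canonical_average vol V N \<beta> A = (\<integral>x. A x \<partial>canonical_measure vol V N \<beta>)"

definition internal_energy ::
    "'m measure \<Rightarrow> ('m \<Rightarrow> 'm list \<Rightarrow> real) \<Rightarrow> nat \<Rightarrow> real \<Rightarrow> real" where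
  "internal_energy vol V N \<beta> = canonical_average vol V N \<beta> (mean_energy V N)"

definition is_energy_density ::
    "'m measure \<Rightarrow> ('m \<Rightarrow> 'm list \<Rightarrow> real) \<Rightarrow> nat \<Rightarrow> real \<Rightarrow> (real \<Rightarrow> real) \<Rightarrow> bool" where
  "is_energy_density vol V N \<beta> \<rho> \<longleftrightarrow> (\<forall>u. 0 \<le> \<rho> u) \<and>
     distributed (canonical_measure vol V N \<beta>) lborel (mean_energy V N) (\<lambda>u. ennreal (\<rho> u))"

text \<open>\<open>E\<close> is an everywhere defined version of \<open>u \<mapsto> \<langle>A|u\<rangle>\<^sub>N\<close>, the same for all inverse
  temperatures; \<open>\<rho> \<beta>\<close> is the density of the mean energy at inverse temperature \<open>\<beta>\<close>. The test
  functions are those for which the left-hand side exists.\<close>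

definition is_microcanonical_average ::
    "'m measure \<Rightarrow> ('m \<Rightarrow> 'm list \<Rightarrow> real) \<Rightarrow> nat \<Rightarrow> (real \<Rightarrow> real \<Rightarrow> real) \<Rightarrow>
     ((nat \<Rightarrow> real \<times> 'm) \<Rightarrow> real) \<Rightarrow> (real \<Rightarrow> real) \<Rightarrow> bool" where
  "is_microcanonical_average vol V N \<rho> A E \<longleftrightarrow>
     E \<in> borel_measurable borel \<and>
     (\<forall>\<beta>>0. \<forall>F\<in>borel_measurable borel.
        integrable (canonical_measure vol V N \<beta>) (\<lambda>x. A x * F (mean_energy V N x)) \<longrightarrow>
        integrable lborel (\<lambda>u. F u * E u * \<rho> \<beta> u) \<and>
        canonical_average vol V N \<beta> (\<lambda>x. A x * F (mean_energy V N x)) =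
          (\<integral>u. F u * E u * \<rho> \<beta> u \<partial>lborel))"

end

theory Submission
  imports Defs "HOL-Real_Asymp.Real_Asymp"
begin

text \<open>Jensen's inequality makes \<open>s \<mapsto> f\<^sub>N(\<beta> - s) - f\<^sub>N(\<beta>) - s u\<^sub>N(\<beta>)\<close> nonnegative, so it has a minimum
  at \<open>s = 0\<close> and \<open>f\<^sub>N' = - u\<^sub>N\<close> without differentiating under the integral. With the uniform bound
  on \<open>f\<^sub>N''\<close>, a second-order Taylor expansion and Chernoff's inequality then bound the probability of
  \<open>\<bar>h\<^sub>N - u\<^sub>N\<bar> \<ge> \<delta>\<close> by \<open>2 exp (- N s \<delta> / 2)\<close> for some \<open>s > 0\<close> independent of \<open>N\<close>. Testing the
  microcanonical average with the indicators of \<open>\<bar>u - u\<^sub>N\<bar> < \<delta>\<close> and of its complement gives the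
  claim; this also bounds \<open>\<langle>A|u\<^sub>N\<rangle>\<close>, whose value at a single point is not controlled by \<open>\<bar>A\<bar> \<le> K\<close>.\<close>

section \<open>Gibbs measures of a single Hamiltonian: exponential moments and mean energy\<close>

locale gibbs_family =
  fixes M :: "'a measure" and H :: "'a \<Rightarrow> real"
  assumes H_measurable [measurable]: "H \<in> borel_measurable M"
    and integrable_weight: "\<And>\<beta>. \<beta> > 0 \<Longrightarrow> integrable M (\<lambda>x. exp (- \<beta> * H x))"
    and not_null: "emeasure M (space M) \<noteq> 0"
begin

text \<open>For the phase space of \<open>N\<close> particles this is \<open>N\<close> times the
  free energy; keeping it unnormalised frees the locale from the particle number.\<close>

definition log_Z :: "real \<Rightarrow> real" where
  "log_Z \<beta> = ln (\<integral>x. exp (- \<beta> * H x) \<partial>M)"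

definition gibbs :: "real \<Rightarrow> 'a measure" where
  "gibbs \<beta> = density M (\<lambda>x. ennreal (exp (- \<beta> * H x - log_Z \<beta>)))"

lemma sets_gibbs [simp, measurable_cong]: "sets (gibbs \<beta>) = sets M"
  by (simp add: gibbs_def)

lemma space_gibbs [simp]: "space (gibbs \<beta>) = space M"
  by (simp add: gibbs_def)

text \<open>A positive function on a space that is not null has a positive integral, so the default
  value \<open>ln 0 = 0\<close> is not met.\<close>

lemma exp_log_Z:
  assumes "\<beta> > 0"
  shows "exp (log_Z \<beta>) = (\<integral>x. exp (- \<beta> * H x) \<partial>M)"
proof -
  have "(\<integral>x. exp (- \<beta> * H x) \<partial>M) \<noteq> 0"
  proof
    assume "(\<integral>x. exp (- \<beta> * H x) \<partial>M) = 0"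
    then have "AE x in M. exp (- \<beta> * H x) = 0"
      using integral_nonneg_eq_0_iff_AE[OF integrable_weight[OF assms]] by simp
    then have "AE x in M. False" by simp
    then show False using not_null by (simp add: AE_iff_null null_setsD1)
  qed
  then have "(\<integral>x. exp (- \<beta> * H x) \<partial>M) > 0"
    by (simp only: order_less_le not_sym simp_thms) simp
  then show ?thesis unfolding log_Z_def by (rule exp_ln)
qed

text \<open>Tilting by \<open>exp (s * H x)\<close> merely moves the inverse temperature from
  \<beta> to \<open>\<beta> - s\<close>, which has to stay positive; hence
  \<open>s < \<beta>\<close>.\<close>

lemma exp_moment:
  assumes "\<beta> > 0" "s < \<beta>"
  shows "integrable (gibbs \<beta>) (\<lambda>x. exp (s * H x))"
    and "(\<integral>x. exp (s * H x) \<partial>gibbs \<beta>) = exp (log_Z (\<beta> - s) - log_Z \<beta>)"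
proof -
  have eq: "exp (- \<beta> * H x - log_Z \<beta>) * exp (s * H x) = exp (- log_Z \<beta>) * exp (- (\<beta> - s) * H x)" for x
    by (simp add: exp_add[symmetric] algebra_simps)
  have int: "integrable M (\<lambda>x. exp (- (\<beta> - s) * H x))"
    using assms by (intro integrable_weight) simp
  show "integrable (gibbs \<beta>) (\<lambda>x. exp (s * H x))"
    unfolding gibbs_def
  proof (subst integrable_density)
    show "integrable M (\<lambda>x. exp (- \<beta> * H x - log_Z \<beta>) *\<^sub>R exp (s * H x))"
      unfolding real_scaleR_def eq using int by (rule integrable_mult_right)
  qed auto
  have "(\<integral>x. exp (s * H x) \<partial>gibbs \<beta>) = (\<integral>x. exp (- log_Z \<beta>) * exp (- (\<beta> - s) * H x) \<partial>M)"
    unfolding gibbs_def by (subst integral_density) (simp_all only: eq real_scaleR_def, auto)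
  also have "\<dots> = exp (- log_Z \<beta>) * exp (log_Z (\<beta> - s))"
    using assms by (simp add: exp_log_Z)
  finally show "(\<integral>x. exp (s * H x) \<partial>gibbs \<beta>) = exp (log_Z (\<beta> - s) - log_Z \<beta>)"
    by (simp add: exp_add[symmetric])
qed

lemma prob_space_gibbs:
  assumes "\<beta> > 0"
  shows "prob_space (gibbs \<beta>)"
proof
  have "emeasure (gibbs \<beta>) (space (gibbs \<beta>)) = (\<integral>\<^sup>+x. ennreal (exp (- \<beta> * H x - log_Z \<beta>)) \<partial>M)"
    by (simp add: gibbs_def emeasure_density cong: nn_integral_cong)
  also have "\<dots> = (\<integral>\<^sup>+x. ennreal (exp (- log_Z \<beta>) * exp (- \<beta> * H x)) \<partial>M)"
    by (simp add: exp_add[symmetric] algebra_simps)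
  also have "\<dots> = ennreal (\<integral>x. exp (- log_Z \<beta>) * exp (- \<beta> * H x) \<partial>M)"
    by (rule nn_integral_eq_integral) (use integrable_weight[OF assms] in \<open>auto intro: integrable_mult_right\<close>)
  also have "(\<integral>x. exp (- log_Z \<beta>) * exp (- \<beta> * H x) \<partial>M) = exp (- log_Z \<beta>) * exp (log_Z \<beta>)"
    using exp_log_Z[OF assms] by simp
  also have "\<dots> = 1" by (simp add: exp_add[symmetric])
  finally show "emeasure (gibbs \<beta>) (space (gibbs \<beta>)) = 1" by simp
qed

text \<open>The exponential moments at \<open>\<beta> / 2\<close> and at
  \<open>- \<beta> / 2\<close> both exist, and their sum dominates a multiple of the absolute value
  of \<open>H\<close> because \<open>y \<le> exp y\<close>.\<close>

lemma integrable_H: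
  assumes "\<beta> > 0"
  shows "integrable (gibbs \<beta>) H"
proof (rule Bochner_Integration.integrable_bound)
  let ?s = "\<beta> / 2"
  show "integrable (gibbs \<beta>) (\<lambda>x. (exp (?s * H x) + exp (- ?s * H x)) / ?s)"
    using assms by (intro integrable_divide Bochner_Integration.integrable_add exp_moment) auto
  have "\<bar>y\<bar> \<le> (exp (?s * y) + exp (- ?s * y)) / ?s" for y
  proof -
    have "?s * y \<le> exp (?s * y)" "- ?s * y \<le> exp (- ?s * y)" "exp (?s * y) > 0" "exp (- ?s * y) > 0"
      using exp_ge_add_one_self[of "?s * y"] exp_ge_add_one_self[of "- ?s * y"] by (linarith | simp)+
    then have "?s * \<bar>y\<bar> \<le> exp (?s * y) + exp (- ?s * y)"
      using assms by (simp only: abs_if split: if_split) (auto simp del: exp_gt_zero)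
    then show ?thesis using assms by (simp add: field_simps)
  qed
  then show "AE x in gibbs \<beta>. norm (H x) \<le> norm ((exp (?s * H x) + exp (- ?s * H x)) / ?s)"
    using assms by (intro AE_I2) (smt (verit, best) abs_ge_self real_norm_def)
qed measurable

text \<open>Integrate the tangent line bound \<open>1 + y \<le> exp y\<close> at
  \<open>y = s * (H x - e)\<close>, with \<open>e\<close> the mean of \<open>H\<close>: the linear
  term integrates to zero and the right-hand side is an exponential moment.\<close>

lemma jensen_log_Z:
  assumes "\<beta> > 0" "s < \<beta>"
  shows "s * (\<integral>x. H x \<partial>gibbs \<beta>) \<le> log_Z (\<beta> - s) - log_Z \<beta>"
proof -
  interpret prob_space "gibbs \<beta>" using assms by (simp add: prob_space_gibbs)
  define e where "e = (\<integral>x. H x \<partial>gibbs \<beta>)"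
  note int = integrable_H[OF assms(1)] exp_moment(1)[OF assms]
  have "1 = (\<integral>x. 1 + s * (H x - e) \<partial>gibbs \<beta>)"
    using int(1) prob_space by (simp add: e_def)
  also have "\<dots> \<le> (\<integral>x. exp (- s * e) * exp (s * H x) \<partial>gibbs \<beta>)"
  proof (rule integral_mono)
    fix x
    show "1 + s * (H x - e) \<le> exp (- s * e) * exp (s * H x)"
      using exp_ge_add_one_self[of "s * (H x - e)"] by (simp add: exp_add[symmetric] algebra_simps)
  qed (use int in auto)
  also have "\<dots> = exp (- s * e) * exp (log_Z (\<beta> - s) - log_Z \<beta>)"
    using exp_moment(2)[OF assms] by simp
  also have "\<dots> = exp (log_Z (\<beta> - s) - log_Z \<beta> - s * e)"
    by (simp add: exp_add[symmetric])
  finally show ?thesis by (simp add: e_def)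
qed

lemma deriv_log_Z:
  assumes "\<beta> > 0" "(log_Z has_real_derivative D) (at \<beta>)"
  shows "D = - (\<integral>x. H x \<partial>gibbs \<beta>)"
proof -
  define e where "e = (\<integral>x. H x \<partial>gibbs \<beta>)"
  have "((\<lambda>s. log_Z (\<beta> - s) - s * e) has_real_derivative - D - e) (at 0)"
    using assms(2) by (auto intro!: derivative_eq_intros DERIV_chain'[where g = log_Z and f = "\<lambda>s. \<beta> - s"])
  \<comment> \<open>The radius \<beta> keeps \<open>s\<close> below \<beta>, where Jensen's
    inequality holds; so 0 is a local minimum and the derivative just computed vanishes.\<close>
  moreover have "\<forall>s. \<bar>0 - s\<bar> < \<beta> \<longrightarrow> log_Z (\<beta> - 0) - 0 * e \<le> log_Z (\<beta> - s) - s * e"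
  proof (intro allI impI)
    fix s assume "\<bar>0 - s\<bar> < \<beta>"
    then have "s < \<beta>" by simp
    then show "log_Z (\<beta> - 0) - 0 * e \<le> log_Z (\<beta> - s) - s * e"
      using jensen_log_Z[OF assms(1)] by (simp add: e_def algebra_simps)
  qed
  ultimately have "- D - e = 0"
    using assms(1) by (intro DERIV_local_min)
  then show ?thesis by (simp add: e_def)
qed

section \<open>Exponential concentration of the energy around its mean\<close>

text \<open>Markov's inequality for \<open>exp (s * H x)\<close>. The sign of \<open>s\<close> is
  left open: positive \<open>s\<close> controls the upper tail of \<open>H\<close>, negative
  \<open>s\<close> the lower one.\<close>

lemma chernoff:
  assumes "\<beta> > 0" "s < \<beta>"
  shows "measure (gibbs \<beta>) {x \<in> space M. c \<le> s * H x} \<le> exp (log_Z (\<beta> - s) - log_Z \<beta> - c)"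
proof -
  have "measure (gibbs \<beta>) {x \<in> space (gibbs \<beta>). exp c \<le> exp (s * H x)}
      \<le> (\<integral>x. exp (s * H x) \<partial>gibbs \<beta>) / exp c"
    by (intro integral_Markov_inequality_measure[where A = "space (gibbs \<beta>)"] exp_moment assms) auto
  then show ?thesis
    by (simp add: exp_moment[OF assms] exp_diff[symmetric])
qed

text \<open>In Chernoff's bound the first-order Taylor term cancels against the mean. Per particle
  there remain a gain \<open>s * \<delta>\<close> and a remainder of at most
  \<open>L * s * s / 2\<close>, and \<open>L * s \<le> \<delta>\<close> makes the remainder at most
  half of the gain.\<close>

lemma exponential_concentration:
  fixes n r s \<delta> L :: real
  assumes n: "n > 0" and r: "r < \<beta>" and s: "0 < s" "s \<le> r" "L * s \<le> \<delta>"
    and D0: "\<And>t. t \<in> {\<beta> - r..\<beta> + r} \<Longrightarrow> ((\<lambda>t. log_Z t / n) has_real_derivative f' t) (at t)"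
    and D1: "\<And>t. t \<in> {\<beta> - r..\<beta> + r} \<Longrightarrow> (f' has_real_derivative f'' t) (at t)"
    and L: "\<And>t. t \<in> {\<beta> - r..\<beta> + r} \<Longrightarrow> f'' t \<le> L"
  shows "measure (gibbs \<beta>) {x \<in> space M. \<delta> \<le> \<bar>H x / n - (\<integral>x. H x / n \<partial>gibbs \<beta>)\<bar>}
    \<le> 2 * exp (- n * s * \<delta> / 2)"
proof -
  have \<beta>: "\<beta> > 0" using r s by linarith
  interpret prob_space "gibbs \<beta>" using \<beta> by (rule prob_space_gibbs)
  define u where "u = (\<integral>x. H x / n \<partial>gibbs \<beta>)"
  have nu: "n * u = (\<integral>x. H x \<partial>gibbs \<beta>)" using n by (simp add: u_def)
  \<comment> \<open>\<open>deriv_log_Z\<close> concerns \<open>log_Z\<close> itself, so the factor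
    \<open>n\<close> is restored before the first derivative at \<beta> is identified with
    \<open>- u\<close>.\<close>
  have "((\<lambda>t. n * (log_Z t / n)) has_real_derivative n * f' \<beta>) (at \<beta>)"
    using D0[of \<beta>] s by (intro DERIV_cmult) auto
  moreover have "(\<lambda>t. n * (log_Z t / n)) = log_Z" using n by auto
  ultimately have "n * f' \<beta> = - (n * u)" using deriv_log_Z[OF \<beta>] nu by simp
  then have "n * f' \<beta> = n * (- u)" by simp
  then have f'\<beta>: "f' \<beta> = - u" using n unfolding mult_cancel_left by simp
  \<comment> \<open>Both tails at once: after division by \<open>n * s\<close>, the event reads
    \<open>H x / n - u \<ge> \<delta>\<close> for \<open>s' = s\<close> and
    \<open>H x / n - u \<le> - \<delta>\<close> for \<open>s' = - s\<close>.\<close>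
  have tail: "measure (gibbs \<beta>) {x \<in> space M. n * (s * \<delta> + s' * u) \<le> s' * H x} \<le> exp (- n * s * \<delta> / 2)"
    if s': "\<bar>s'\<bar> = s" for s'
  proof -
    \<comment> \<open>The sequence of successive derivatives in the form that \<open>Taylor\<close>
      expects; only the indices 0, 1 and 2 matter.\<close>
    define d where "d m = (if m = 0 then \<lambda>t. log_Z t / n else if m = 1 then f' else f'')" for m :: nat
    have "\<exists>t. (if \<beta> - s' < \<beta> then \<beta> - s' < t \<and> t < \<beta> else \<beta> < t \<and> t < \<beta> - s') \<and>
        log_Z (\<beta> - s') / n = (\<Sum>m<2. d m \<beta> / fact m * (\<beta> - s' - \<beta>) ^ m) + d 2 t / fact 2 * (\<beta> - s' - \<beta>) ^ 2"
      by (rule Taylor[where a = "\<beta> - r" and b = "\<beta> + r"])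
         (use s s' D0 D1 in \<open>auto simp: d_def less_2_cases_iff\<close>)
    then obtain t where t0: "if \<beta> - s' < \<beta> then \<beta> - s' < t \<and> t < \<beta> else \<beta> < t \<and> t < \<beta> - s'"
      and T: "log_Z (\<beta> - s') / n = (\<Sum>m<2. d m \<beta> / fact m * (\<beta> - s' - \<beta>) ^ m) + d 2 t / fact 2 * (\<beta> - s' - \<beta>) ^ 2"
      by blast
    have t: "t \<in> {\<beta> - r..\<beta> + r}"
      using t0 s s' by (auto split: if_splits)
    have "log_Z (\<beta> - s') / n = log_Z \<beta> / n + s' * u + f'' t / 2 * s'\<^sup>2"
      using T by (simp add: d_def f'\<beta> numeral_2_eq_2)
    also have "f'' t / 2 * s'\<^sup>2 \<le> L / 2 * s'\<^sup>2"
      using L[OF t] by (intro mult_right_mono) auto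
    also have "L / 2 * s'\<^sup>2 = (L * s) * s / 2" by (simp add: power2_eq_square s'[symmetric] abs_mult[symmetric])
    also have "\<dots> \<le> \<delta> * s / 2" using s by (simp add: mult_right_mono)
    finally have "log_Z (\<beta> - s') / n - log_Z \<beta> / n - (s * \<delta> + s' * u) \<le> - s * \<delta> / 2"
      by (simp add: mult.commute)
    then have "n * (log_Z (\<beta> - s') / n - log_Z \<beta> / n - (s * \<delta> + s' * u)) \<le> n * (- s * \<delta> / 2)"
      using n by (intro mult_left_mono) auto
    moreover have "n * (log_Z (\<beta> - s') / n - log_Z \<beta> / n - (s * \<delta> + s' * u)) =
        log_Z (\<beta> - s') - log_Z \<beta> - n * (s * \<delta> + s' * u)"
      using n by (simp add: right_diff_distrib)
    ultimately have "log_Z (\<beta> - s') - log_Z \<beta> - n * (s * \<delta> + s' * u) \<le> - n * s * \<delta> / 2"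
      by simp
    then show ?thesis
      using chernoff[OF \<beta>, of s' "n * (s * \<delta> + s' * u)"] s s' r by (smt (verit) exp_le_cancel_iff)
  qed
  have "{x \<in> space M. \<delta> \<le> \<bar>H x / n - u\<bar>} \<subseteq>
      {x \<in> space M. n * (s * \<delta> + s * u) \<le> s * H x} \<union> {x \<in> space M. n * (s * \<delta> + (- s) * u) \<le> (- s) * H x}"
  proof
    fix x assume "x \<in> {x \<in> space M. \<delta> \<le> \<bar>H x / n - u\<bar>}"
    then have x: "x \<in> space M" and "\<delta> \<le> H x / n - u \<or> \<delta> \<le> - (H x / n - u)" by auto
    then have "s * n * \<delta> \<le> s * n * (H x / n - u) \<or> s * n * \<delta> \<le> s * n * (- (H x / n - u))"
      using s n by auto
    moreover have "s * n * (H x / n - u) = s * H x - n * s * u" using n by (simp add: field_simps)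
    ultimately show "x \<in> {x \<in> space M. n * (s * \<delta> + s * u) \<le> s * H x} \<union>
        {x \<in> space M. n * (s * \<delta> + (- s) * u) \<le> (- s) * H x}"
      using x by (auto simp: algebra_simps)
  qed
  then have "measure (gibbs \<beta>) {x \<in> space M. \<delta> \<le> \<bar>H x / n - u\<bar>} \<le>
      measure (gibbs \<beta>) ({x \<in> space M. n * (s * \<delta> + s * u) \<le> s * H x} \<union>
        {x \<in> space M. n * (s * \<delta> + (- s) * u) \<le> (- s) * H x})"
    by (intro finite_measure_mono) auto
  also have "\<dots> \<le> measure (gibbs \<beta>) {x \<in> space M. n * (s * \<delta> + s * u) \<le> s * H x} +
      measure (gibbs \<beta>) {x \<in> space M. n * (s * \<delta> + (- s) * u) \<le> (- s) * H x}"
    by (intro measure_Un_le) auto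
  also have "\<dots> \<le> 2 * exp (- n * s * \<delta> / 2)"
    using tail[of s] tail[of "- s"] s by simp
  finally show ?thesis by (simp add: u_def)
qed

end

section \<open>Averages and their conditional versions given the energy\<close>

text \<open>Split according to whether \<open>h\<close> is within \<delta> of \<open>v\<close>. Far
  from \<open>v\<close> the bound \<open>K\<close> is used; near \<open>v\<close>, \<open>E\<close>
  is replaced by \<open>E v\<close> at cost \<epsilon>. The factor of \<open>E v\<close> remains the
  probability of the near event, since no bound on \<open>E v\<close> is at hand; the caller
  extracts one from this inequality.\<close>

lemma (in prob_space) average_conditional_bound:
  fixes A h :: "'a \<Rightarrow> real" and E \<rho> :: "real \<Rightarrow> real"
  assumes dist: "distributed M lborel h (\<lambda>u. ennreal (\<rho> u))" and \<rho>: "\<And>u. 0 \<le> \<rho> u"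
    and A [measurable]: "A \<in> borel_measurable M" and K: "\<And>x. x \<in> space M \<Longrightarrow> \<bar>A x\<bar> \<le> K"
    and cond: "\<And>F. F \<in> borel_measurable borel \<Longrightarrow> integrable M (\<lambda>x. A x * F (h x)) \<Longrightarrow>
        integrable lborel (\<lambda>u. F u * E u * \<rho> u) \<and>
        (\<integral>x. A x * F (h x) \<partial>M) = (\<integral>u. F u * E u * \<rho> u \<partial>lborel)"
    and near: "\<And>u. \<bar>u - v\<bar> < \<delta> \<Longrightarrow> \<bar>E u - E v\<bar> < \<epsilon>" and \<epsilon>: "\<epsilon> > 0"
  shows "\<bar>(\<integral>x. A x \<partial>M) - E v * (1 - prob {x \<in> space M. \<delta> \<le> \<bar>h x - v\<bar>})\<bar>
    \<le> \<epsilon> + K * prob {x \<in> space M. \<delta> \<le> \<bar>h x - v\<bar>}"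
proof -
  have h [measurable]: "h \<in> borel_measurable M"
    using distributed_measurable[OF dist] by simp
  define S where "S = {u. \<delta> \<le> \<bar>u - v\<bar>}"
  have S [measurable]: "S \<in> sets borel" unfolding S_def by measurable
  define q where "q = prob {x \<in> space M. \<delta> \<le> \<bar>h x - v\<bar>}"
  have K0: "K \<ge> 0" using K not_empty abs_ge_zero by (metis all_not_in_conv order_trans)
  have int: "integrable M (\<lambda>x. A x * indicator T (h x))" if [measurable]: "T \<in> sets borel" for T
    by (rule integrable_const_bound[where B = K]) (use K K0 in \<open>auto simp: indicator_def\<close>)
  have \<rho>_int: "integrable lborel (\<lambda>u. \<rho> u * indicator T u)"
    and \<rho>_eq: "(\<integral>u. \<rho> u * indicator T u \<partial>lborel) = (\<integral>x. indicator T (h x) \<partial>M)"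
    if [measurable]: "T \<in> sets borel" for T
  proof -
    have "integrable M (\<lambda>x. indicator T (h x) :: real)"
      by (rule integrable_const_bound[where B = 1]) (auto simp: indicator_def)
    then show "integrable lborel (\<lambda>u. \<rho> u * indicator T u)"
      using distributed_integrable[OF dist, of "indicator T"] \<rho> by simp
    show "(\<integral>u. \<rho> u * indicator T u \<partial>lborel) = (\<integral>x. indicator T (h x) \<partial>M)"
      using distributed_integral[OF dist, of "indicator T"] \<rho> by simp
  qed
  have ind_S: "(\<integral>x. indicator S (h x) \<partial>M) = q"
  proof -
    have "(\<integral>x. indicator S (h x) \<partial>M) = (\<integral>x. indicator {x \<in> space M. \<delta> \<le> \<bar>h x - v\<bar>} x \<partial>M)"
      by (intro Bochner_Integration.integral_cong) (auto simp: S_def indicator_def)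
    also have "\<dots> = q" by (simp add: q_def)
    finally show ?thesis .
  qed
  have ind_mS: "(\<integral>x. indicator (- S) (h x) \<partial>M) = 1 - q"
  proof -
    have "(\<integral>x. indicator (- S) (h x) \<partial>M) = (\<integral>x. (1 :: real) - indicator S (h x) \<partial>M)"
      by (intro Bochner_Integration.integral_cong) (auto simp: indicator_def)
    also have "\<dots> = (\<integral>x. 1 \<partial>M) - (\<integral>x. indicator S (h x) \<partial>M)"
    proof (rule Bochner_Integration.integral_diff)
      show "integrable M (\<lambda>x. indicator S (h x) :: real)"
        by (rule integrable_const_bound[where B = 1]) (auto simp: indicator_def)
    qed simp
    finally show ?thesis by (simp add: ind_S prob_space)
  qed
  have split: "(\<integral>x. A x \<partial>M) = (\<integral>x. A x * indicator S (h x) \<partial>M) + (\<integral>x. A x * indicator (- S) (h x) \<partial>M)"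
  proof -
    have "(\<integral>x. A x \<partial>M) = (\<integral>x. A x * indicator S (h x) + A x * indicator (- S) (h x) \<partial>M)"
      by (intro Bochner_Integration.integral_cong) (auto simp: indicator_def)
    also have "\<dots> = (\<integral>x. A x * indicator S (h x) \<partial>M) + (\<integral>x. A x * indicator (- S) (h x) \<partial>M)"
      by (intro Bochner_Integration.integral_add int) auto
    finally show ?thesis .
  qed
  have far: "\<bar>\<integral>x. A x * indicator S (h x) \<partial>M\<bar> \<le> K * q"
  proof -
    have "\<bar>\<integral>x. A x * indicator S (h x) \<partial>M\<bar> \<le> (\<integral>x. \<bar>A x * indicator S (h x)\<bar> \<partial>M)"
      by (rule integral_abs_bound)
    also have "\<dots> \<le> (\<integral>x. K * indicator S (h x) \<partial>M)"
    proof (rule integral_mono)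
      show "integrable M (\<lambda>x. \<bar>A x * indicator S (h x)\<bar>)" by (intro integrable_abs int S)
      show "integrable M (\<lambda>x. K * indicator S (h x))"
        by (rule integrable_const_bound[where B = K]) (use K0 in \<open>auto simp: indicator_def\<close>)
    qed (use K in \<open>auto simp: indicator_def\<close>)
    also have "\<dots> = K * q" by (simp add: ind_S)
    finally show ?thesis .
  qed
  \<comment> \<open>The test function is the indicator of \<open>- S\<close>. Writing
    \<open>1 - q\<close> as the integral of \<rho> over \<open>- S\<close> merges the difference
    into one integral, whose integrand is at most \<epsilon> times \<rho> there.\<close>
  have close: "\<bar>(\<integral>x. A x * indicator (- S) (h x) \<partial>M) - E v * (1 - q)\<bar> \<le> \<epsilon>"
  proof -
    let ?g = "\<lambda>u. indicator (- S) u * E u * \<rho> u"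
    have g: "integrable lborel ?g" "(\<integral>x. A x * indicator (- S) (h x) \<partial>M) = (\<integral>u. ?g u \<partial>lborel)"
      using cond[of "indicator (- S)"] int[of "- S"] by auto
    have \<rho>S: "integrable lborel (\<lambda>u. \<rho> u * indicator (- S) u)" by (rule \<rho>_int) auto
    have "E v * (1 - q) = (\<integral>u. E v * (\<rho> u * indicator (- S) u) \<partial>lborel)"
      using \<rho>_eq[of "- S"] by (simp add: ind_mS)
    then have "(\<integral>x. A x * indicator (- S) (h x) \<partial>M) - E v * (1 - q) =
        (\<integral>u. ?g u - E v * (\<rho> u * indicator (- S) u) \<partial>lborel)"
      using g \<rho>S by simp
    also have "\<bar>\<dots>\<bar> \<le> (\<integral>u. \<bar>?g u - E v * (\<rho> u * indicator (- S) u)\<bar> \<partial>lborel)"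
      by (rule integral_abs_bound)
    also have "\<dots> \<le> (\<integral>u. \<epsilon> * (\<rho> u * indicator (- S) u) \<partial>lborel)"
    proof (rule integral_mono)
      fix u
      have "\<bar>E u - E v\<bar> * \<rho> u \<le> \<epsilon> * \<rho> u" if "u \<notin> S"
        using near[of u] \<rho>[of u] that by (intro mult_right_mono) (auto simp: S_def)
      then show "\<bar>?g u - E v * (\<rho> u * indicator (- S) u)\<bar> \<le> \<epsilon> * (\<rho> u * indicator (- S) u)"
        using \<rho>[of u] by (auto simp: indicator_def abs_mult left_diff_distrib[symmetric])
    qed (use g \<rho>S in auto)
    also have "\<dots> = \<epsilon> * (1 - q)"
      using \<rho>_eq[of "- S"] by (simp add: ind_mS)
    also have "\<dots> \<le> \<epsilon>" using \<epsilon> by (simp add: q_def)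
    finally show ?thesis .
  qed
  show ?thesis using split far close unfolding q_def[symmetric] by linarith
qed

section \<open>The particle system and the limit of large \<open>N\<close>\<close>

text \<open>On a null phase space every partition function is 0, so by \<open>ln 0 = 0\<close> the
  free energy is constantly 0; a nonzero second derivative excludes this. As
  \<open>N \<ge> 1\<close>, measurability passes from the mean energy to the Hamiltonian.\<close>

lemma gibbs_family_phase_space:
  fixes V :: "'m::topological_space \<Rightarrow> 'm list \<Rightarrow> real"
  assumes N: "N \<ge> 1"
    and finite: "\<And>\<beta>. \<beta> > 0 \<Longrightarrow> partition_function vol V N \<beta> < \<infinity>"
    and meas: "mean_energy V N \<in> borel_measurable (phase_space vol N)"
    and nontrivial: "(deriv ^^ 2) (free_energy vol V N) \<beta> \<noteq> 0"
  shows "gibbs_family (phase_space vol N) (hamiltonian V N)"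
proof
  have "hamiltonian V N = (\<lambda>x. real N * mean_energy V N x)"
    using N by (auto simp: mean_energy_def)
  then show H [measurable]: "hamiltonian V N \<in> borel_measurable (phase_space vol N)"
    using meas by simp
  show "integrable (phase_space vol N) (\<lambda>x. exp (- \<beta> * hamiltonian V N x))" if "\<beta> > 0" for \<beta>
    using finite[OF that] by (intro integrableI_nonneg) (auto simp: partition_function_def)
  show "emeasure (phase_space vol N) (space (phase_space vol N)) \<noteq> 0"
  proof
    assume null: "emeasure (phase_space vol N) (space (phase_space vol N)) = 0"
    have "partition_function vol V N \<beta> = 0" for \<beta>
      using null unfolding partition_function_def
      by (subst nn_integral_0_iff_AE) (auto simp: AE_iff_null null_setsI)
    then have "free_energy vol V N = (\<lambda>_. 0)"
      by (auto simp: free_energy_def)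
    then show False using nontrivial by (simp add: numeral_2_eq_2)
  qed
qed

theorem mainTheorem6:
  fixes \<A> :: "'m::{second_countable_topology, t2_space} chart set"
    and g :: "'m chart \<Rightarrow> real \<Rightarrow> real"
    and vol :: "'m measure"
    and V :: "'m \<Rightarrow> 'm list \<Rightarrow> real"
    and J :: "real set" and C :: "real \<Rightarrow> real" and \<beta> \<sigma> K :: real
    and \<rho> :: "nat \<Rightarrow> real \<Rightarrow> real \<Rightarrow> real"
    and A :: "nat \<Rightarrow> (nat \<Rightarrow> real \<times> 'm) \<Rightarrow> real"
    and E :: "nat \<Rightarrow> real \<Rightarrow> real"
  assumes atlas: "smooth_atlas \<A>"
    and metric: "riemannian_metric \<A> g"
    and volume: "volume_measure \<A> g vol"
    and potential: "smooth_potential \<A> V"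
    and finite: "\<And>N \<beta>'. N \<ge> 1 \<Longrightarrow> \<beta>' > 0 \<Longrightarrow> partition_function vol V N \<beta>' < \<infinity>"
    and diff2: "\<And>N. N \<ge> 1 \<Longrightarrow> times_differentiable_on 2 (free_energy vol V N) {0<..}"
    and J: "open J" "is_interval J" "J \<subseteq> {0<..}"
    and diff4: "\<And>N. N \<ge> 1 \<Longrightarrow> times_differentiable_on 4 (free_energy vol V N) J"
    and deriv_bound: "\<And>N j \<beta>'. N \<ge> 1 \<Longrightarrow> j \<le> 4 \<Longrightarrow> \<beta>' \<in> J \<Longrightarrow>
          \<bar>(deriv ^^ j) (free_energy vol V N) \<beta>'\<bar> \<le> C \<beta>'"
    and C_bounded: "\<And>a b. {a..b} \<subseteq> J \<Longrightarrow> bounded (C ` {a..b})"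
    and beta: "\<beta> \<in> J"
    and sigma: "\<sigma>\<^sup>2 > 0"
      "\<And>N. N \<ge> 1 \<Longrightarrow> (deriv ^^ 2) (free_energy vol V N) \<beta> \<ge> \<sigma>\<^sup>2"
    and density: "\<And>N \<beta>'. N \<ge> 1 \<Longrightarrow> \<beta>' > 0 \<Longrightarrow> is_energy_density vol V N \<beta>' (\<rho> N \<beta>')"
    and A_measurable: "\<And>N. N \<ge> 1 \<Longrightarrow> A N \<in> borel_measurable (phase_space vol N)"
    and A_bounded: "\<And>N x. N \<ge> 1 \<Longrightarrow> x \<in> space (phase_space vol N) \<Longrightarrow> \<bar>A N x\<bar> \<le> K"
    and microcanonical: "\<And>N. N \<ge> 1 \<Longrightarrow> is_microcanonical_average vol V N (\<rho> N) (A N) (E N)"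
    and equicontinuous: "\<And>\<epsilon>. \<epsilon> > 0 \<Longrightarrow> \<exists>\<delta>>0. \<forall>N\<ge>1. \<forall>u.
          \<bar>u - internal_energy vol V N \<beta>\<bar> < \<delta> \<longrightarrow>
          \<bar>E N u - E N (internal_energy vol V N \<beta>)\<bar> < \<epsilon>"
  shows "(\<lambda>N. canonical_average vol V N \<beta> (A N) - E N (internal_energy vol V N \<beta>))
           \<longlonglongrightarrow> 0"
proof (rule LIMSEQ_I)
  fix \<eta> :: real assume \<eta>: "\<eta> > 0"
  let ?u = "\<lambda>N. internal_energy vol V N \<beta>"
  let ?f = "free_energy vol V"
  have \<beta>: "\<beta> > 0" using beta J by auto
  \<comment> \<open>The final error is at most \<epsilon> plus a multiple of \<open>q N\<close>,
    which is made smaller than \<epsilon>.\<close>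
  define \<epsilon> where "\<epsilon> = \<eta> / 2"
  have \<epsilon>: "\<epsilon> > 0" using \<eta> by (simp add: \<epsilon>_def)
  obtain \<delta> where \<delta>: "\<delta> > 0"
    and near: "\<And>N u. N \<ge> 1 \<Longrightarrow> \<bar>u - ?u N\<bar> < \<delta> \<Longrightarrow> \<bar>E N u - E N (?u N)\<bar> < \<epsilon>"
    using equicontinuous[OF \<epsilon>] by blast
  obtain r where r: "r > 0" "{\<beta> - r..\<beta> + r} \<subseteq> J"
  proof -
    obtain r where "r > 0" "cball \<beta> r \<subseteq> J" using J(1) beta open_contains_cball by blast
    then show ?thesis using that by (simp add: cball_eq_atLeastAtMost)
  qed
  have "\<beta> - r \<in> {0<..}" using r J(3) by (intro subsetD[OF J(3)] subsetD[OF r(2)]) auto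
  then have r\<beta>: "r < \<beta>" by simp
  \<comment> \<open>A bound on the second derivatives near \<beta> that is the same for all
    \<open>N\<close>; this is where the local boundedness of \<open>C\<close> enters.\<close>
  obtain L where L: "L > 0" "\<And>t. t \<in> {\<beta> - r..\<beta> + r} \<Longrightarrow> C t \<le> L"
  proof -
    obtain L where "L > 0" "\<And>t. t \<in> {\<beta> - r..\<beta> + r} \<Longrightarrow> norm (C t) \<le> L"
      using C_bounded[OF r(2)] unfolding bounded_pos by auto
    then show ?thesis using that by force
  qed
  \<comment> \<open>The largest \<open>s\<close> that the concentration estimate admits. It does not
    depend on \<open>N\<close>, so the probability of a deviation decays exponentially in
    \<open>N\<close>.\<close>
  define s where "s = min r (\<delta> / L)"
  have s: "0 < s" "s \<le> r" "L * s \<le> \<delta>"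
    using r L \<delta> by (auto simp: s_def min_def field_simps)
  define q where
    "q N = measure (canonical_measure vol V N \<beta>)
      {x \<in> space (phase_space vol N). \<delta> \<le> \<bar>mean_energy V N x - ?u N\<bar>}" for N
  have bounds: "q N \<le> 2 * exp (- real N * s * \<delta> / 2)"
    "\<bar>canonical_average vol V N \<beta> (A N) - E N (?u N) * (1 - q N)\<bar> \<le> \<epsilon> + K * q N"
    "\<bar>canonical_average vol V N \<beta> (A N)\<bar> \<le> K"
    if N: "N \<ge> 1" for N
  proof -
    have dist: "distributed (canonical_measure vol V N \<beta>) lborel (mean_energy V N) (\<lambda>u. ennreal (\<rho> N \<beta> u))"
      and \<rho>: "\<And>u. 0 \<le> \<rho> N \<beta> u"
      using density[OF N \<beta>] by (auto simp: is_energy_density_def)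
    \<comment> \<open>Having a density includes being measurable, and the canonical measure has the
      measurable sets of the phase space.\<close>
    have meas: "mean_energy V N \<in> borel_measurable (phase_space vol N)"
      using distributed_measurable[OF dist] by (simp add: canonical_measure_def)
    interpret gibbs_family "phase_space vol N" "hamiltonian V N"
      using sigma(1) sigma(2)[OF N]
      by (intro gibbs_family_phase_space[where \<beta> = \<beta>] N finite meas) auto
    \<comment> \<open>Valid for every real \<open>t\<close>: where the integral diverges, both
      \<open>enn2real\<close> and the Bochner integral give 0.\<close>
    have logZ: "?f N = (\<lambda>t. log_Z t / real N)"
      by (auto simp: free_energy_def log_Z_def partition_function_def integral_eq_nn_integral)
    have can: "canonical_measure vol V N \<beta> = gibbs \<beta>"
      using N by (simp add: canonical_measure_def gibbs_def logZ)
    interpret prob_space "gibbs \<beta>" using \<beta> by (rule prob_space_gibbs)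
    have D: "((deriv ^^ j) (?f N) has_real_derivative (deriv ^^ Suc j) (?f N) t) (at t)"
      if "j < 2" "t \<in> {\<beta> - r..\<beta> + r}" for j t
      using diff4[OF N] that r(2) by (auto simp: times_differentiable_on_def DERIV_deriv_iff_field_differentiable)
    have "measure (gibbs \<beta>) {x \<in> space (phase_space vol N).
          \<delta> \<le> \<bar>hamiltonian V N x / real N - (\<integral>x. hamiltonian V N x / real N \<partial>gibbs \<beta>)\<bar>}
        \<le> 2 * exp (- real N * s * \<delta> / 2)"
    proof (rule exponential_concentration[OF _ r\<beta> s])
      fix t assume t: "t \<in> {\<beta> - r..\<beta> + r}"
      show "((\<lambda>t. log_Z t / real N) has_real_derivative deriv (?f N) t) (at t)"
        using D[of 0 t] t by (simp add: logZ)
      show "(deriv (?f N) has_real_derivative (deriv ^^ 2) (?f N) t) (at t)"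
        using D[of 1 t] t by (simp add: numeral_2_eq_2)
      show "(deriv ^^ 2) (?f N) t \<le> L"
        using deriv_bound[OF N, of 2 t] L(2)[OF t] t r(2) by fastforce
    qed (use N in simp)
    then show "q N \<le> 2 * exp (- real N * s * \<delta> / 2)"
      by (simp add: q_def can internal_energy_def canonical_average_def mean_energy_def[abs_def])
    have A: "A N \<in> borel_measurable (gibbs \<beta>)" using A_measurable[OF N] by simp
    have micro: "\<And>F. F \<in> borel_measurable borel \<Longrightarrow> integrable (gibbs \<beta>) (\<lambda>x. A N x * F (mean_energy V N x)) \<Longrightarrow>
        integrable lborel (\<lambda>u. F u * E N u * \<rho> N \<beta> u) \<and>
        (\<integral>x. A N x * F (mean_energy V N x) \<partial>gibbs \<beta>) = (\<integral>u. F u * E N u * \<rho> N \<beta> u \<partial>lborel)"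
      using microcanonical[OF N] \<beta>
      unfolding is_microcanonical_average_def canonical_average_def can[symmetric] by blast+
    have "\<bar>(\<integral>x. A N x \<partial>gibbs \<beta>) - E N (?u N) *
          (1 - prob {x \<in> space (gibbs \<beta>). \<delta> \<le> \<bar>mean_energy V N x - ?u N\<bar>})\<bar>
        \<le> \<epsilon> + K * prob {x \<in> space (gibbs \<beta>). \<delta> \<le> \<bar>mean_energy V N x - ?u N\<bar>}"
      using dist A_bounded[OF N] near[OF N]
      by (intro average_conditional_bound[where \<rho> = "\<rho> N \<beta>"] \<rho> A micro \<epsilon>) (auto simp: can)
    then show "\<bar>canonical_average vol V N \<beta> (A N) - E N (?u N) * (1 - q N)\<bar> \<le> \<epsilon> + K * q N"
      by (simp add: q_def can canonical_average_def)
    have "\<bar>\<integral>x. A N x \<partial>gibbs \<beta>\<bar> \<le> (\<integral>x. \<bar>A N x\<bar> \<partial>gibbs \<beta>)" by (rule integral_abs_bound)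
    also have "\<dots> \<le> K"
      using A A_bounded[OF N] by (intro integral_le_const integrable_const_bound[where B = K]) auto
    finally show "\<bar>canonical_average vol V N \<beta> (A N)\<bar> \<le> K"
      by (simp add: can canonical_average_def)
  qed
  have K: "K \<ge> 0" using bounds(3)[of 1] by linarith
  have q0: "q N \<ge> 0" for N by (simp add: q_def)
  \<comment> \<open>The coefficient of \<open>q N\<close> in the final estimate: \<open>K\<close>
    from the far part and \<open>4 * K + 2 * \<epsilon>\<close> from the bound on \<open>e\<close>;
    the summand 1 makes it positive.\<close>
  define B where "B = 5 * K + 2 * \<epsilon> + 1"
  have B: "B > 0" using K \<epsilon> by (simp add: B_def)
  \<comment> \<open>Below \<open>1 / 2\<close> the factor \<open>1 - q N\<close> can be divided out
    to bound \<open>e\<close>; below \<open>\<epsilon> / B\<close> the remaining error is less than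
    \<epsilon>.\<close>
  define \<kappa> where "\<kappa> = min (1 / 2) (\<epsilon> / B)"
  have \<kappa>: "\<kappa> > 0" using \<epsilon> B by (simp add: \<kappa>_def)
  have "(\<lambda>N. 2 * exp (- real N * s * \<delta> / 2)) \<longlonglongrightarrow> 0"
    using s(1) \<delta> by real_asymp
  then have "eventually (\<lambda>N. 2 * exp (- real N * s * \<delta> / 2) < \<kappa>) sequentially"
    using \<kappa> by (rule order_tendstoD)
  then obtain N0 where N0: "\<And>N. N \<ge> N0 \<Longrightarrow> 2 * exp (- real N * s * \<delta> / 2) < \<kappa>"
    unfolding eventually_sequentially by blast
  have "norm (canonical_average vol V N \<beta> (A N) - E N (?u N) - 0) < \<eta>" if N: "N \<ge> max 1 N0" for N
  proof -
    define a where "a = canonical_average vol V N \<beta> (A N)"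
    define e where "e = E N (?u N)"
    have b: "\<bar>a - e * (1 - q N)\<bar> \<le> \<epsilon> + K * q N" "\<bar>a\<bar> \<le> K"
      using bounds(2,3)[of N] N by (auto simp: a_def e_def)
    have "q N < \<kappa>" using bounds(1)[of N] N0[of N] N by simp
    then have q: "q N < 1 / 2" "B * q N < \<epsilon>"
      using B by (auto simp: \<kappa>_def field_simps)
    \<comment> \<open>The microcanonical value at the mean energy is bounded through the canonical
      average, which is at most \<open>K\<close> in absolute value.\<close>
    have "\<bar>e\<bar> * (1 / 2) \<le> \<bar>e\<bar> * (1 - q N)" using q by (intro mult_left_mono) auto
    also have "\<dots> = \<bar>e * (1 - q N)\<bar>" using q by (simp add: abs_mult)
    also have "\<dots> \<le> K + \<epsilon> + K * q N" using b by linarith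
    also have "K * q N \<le> K * 1" using q K by (intro mult_left_mono) auto
    finally have "\<bar>e\<bar> \<le> 4 * K + 2 * \<epsilon>" by simp
    then have "\<bar>e * q N\<bar> \<le> (4 * K + 2 * \<epsilon>) * q N"
      using q0[of N] by (simp add: abs_mult mult_right_mono)
    moreover have "a - e = (a - e * (1 - q N)) - e * q N" by (simp add: algebra_simps)
    ultimately have "\<bar>a - e\<bar> \<le> \<epsilon> + K * q N + (4 * K + 2 * \<epsilon>) * q N" using b by linarith
    also have "\<dots> \<le> \<epsilon> + B * q N" using q0[of N] by (simp add: B_def algebra_simps)
    also have "\<dots> < \<eta>" using q by (simp add: \<epsilon>_def)
    finally show ?thesis by (simp add: a_def e_def)
  qed
  then show "\<exists>no. \<forall>N\<ge>no. norm (canonical_average vol V N \<beta> (A N) - E N (?u N) - 0) < \<eta>"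
    by blast
qed

end
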